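(* Let $K$ be a field of characteristic $\ne 2,3$. Every linear transformation on the vector space of cubic forms $K^2\to K$ that preserves the discriminant is of the form $q\mapsto c\,(q\circ g)$ for some $c\in K^\times$ and $g\in\mathrm{GL}_2(K)$ such that $c^4(\det g)^6=1$.
   Context: The space of binary cubic forms is the 4-dimensional space $V$ of homogeneous cubic polynomials $a_0x^3+a_1x^2y+a_2xy^2+a_3y^3$ in two variables over $K$. The discriminant is the degree-4 polynomial function $f$ on $V$ given by $$f(a_0x^3+a_1x^2y+a_2xy^2+a_3y^3)=a_1^2a_2^2+18a_0a_1a_2a_3-4a_0a_2^3-4a_1^3a_3-27a_0^2a_3^2.$$ A linear transformation $\phi$ preserves $f$ if $f\circ\phi=f$ as polynomials in $a_0,\dots,a_3$. *)

theory Defs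
  imports "HOL-Analysis.Determinants" "HOL-Library.Poly_Mapping"
begin

text \<open>Formal multivariate polynomials over \<open>'a\<close> with variables indexed by \<open>'v\<close>.\<close>

type_synonym ('v, 'a) mpoly = "('v \<Rightarrow>\<^sub>0 nat) \<Rightarrow>\<^sub>0 'a"

definition Const :: "'a::comm_ring_1 \<Rightarrow> ('v, 'a) mpoly" where
  "Const c = Poly_Mapping.single 0 c"

definition Var :: "'v \<Rightarrow> ('v, 'a::comm_ring_1) mpoly" where
  "Var i = Poly_Mapping.single (Poly_Mapping.single i 1) 1"

definition mp_subst :: "('v \<Rightarrow> ('w, 'a) mpoly) \<Rightarrow> ('v, 'a::comm_ring_1) mpoly \<Rightarrow> ('w, 'a) mpoly" where
  "mp_subst \<sigma> p = (\<Sum>m\<in>Poly_Mapping.keys p.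
     Const (Poly_Mapping.lookup p m) *
     (\<Prod>i\<in>Poly_Mapping.keys m. \<sigma> i ^ Poly_Mapping.lookup m i))"

text \<open>Binary forms use the index type \<open>2\<close>, so that the variable \<open>x\<close> is \<open>Var 1\<close> and \<open>y\<close> is
  \<open>Var 2\<close>, matching the components of vectors of type \<open>'a ^ 2\<close>.\<close>

definition binary_cubics :: "(2, 'a::comm_ring_1) mpoly set" where
  "binary_cubics = {q. \<forall>m\<in>Poly_Mapping.keys q. (\<Sum>i\<in>UNIV. Poly_Mapping.lookup m i) = 3}"

text \<open>The monomial of coefficient \<open>a\<^sub>j\<close> is \<open>x\<^bsup>3-j\<^esup> y\<^bsup>j\<^esup>\<close>, for \<open>j \<le> 3\<close>.\<close>

definition cubic_expo :: "nat \<Rightarrow> (2 \<Rightarrow>\<^sub>0 nat)" where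
  "cubic_expo j = Poly_Mapping.single 1 (3 - j) + Poly_Mapping.single 2 j"

definition cubic_monom :: "nat \<Rightarrow> (2, 'a::comm_ring_1) mpoly" where
  "cubic_monom j = Var 1 ^ (3 - j) * Var 2 ^ j"

definition cubic_coeff :: "(2, 'a::comm_ring_1) mpoly \<Rightarrow> nat \<Rightarrow> 'a" where
  "cubic_coeff q j = Poly_Mapping.lookup q (cubic_expo j)"

lemma cubic_monom_eq:
  assumes "j \<le> 3"
  shows "cubic_monom j = Poly_Mapping.single (cubic_expo j) (1::'a::comm_ring_1)"
proof -
  have pow: "(Var i :: (2, 'a) mpoly) ^ n = Poly_Mapping.single (Poly_Mapping.single i n) 1" for i n
    by (induction n) (simp_all add: Var_def mult_single single_add [symmetric] single_one)
  show ?thesis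
    by (simp add: cubic_monom_def cubic_expo_def pow mult_single)
qed

lemma lookup_cubic_expo:
  "Poly_Mapping.lookup (cubic_expo j) 1 = 3 - j" "Poly_Mapping.lookup (cubic_expo j) 2 = j"
  by (simp_all add: cubic_expo_def lookup_add lookup_single)

lemma binary_cubics_iff:
  "q \<in> binary_cubics \<longleftrightarrow> (\<exists>a::nat \<Rightarrow> 'a::comm_ring_1. q = (\<Sum>j\<le>3. Const (a j) * cubic_monom j))"
proof -
  have inj: "inj_on cubic_expo {..3}"
    by (rule inj_onI) (metis lookup_cubic_expo(2))
  have sum_eq: "(\<Sum>j\<le>3. Const (a j) * cubic_monom j) =
      (\<Sum>j\<le>3. Poly_Mapping.single (cubic_expo j) (a j))" for a :: "nat \<Rightarrow> 'a"
    by (rule sum.cong) (simp_all add: cubic_monom_eq Const_def mult_single)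
  show ?thesis
  proof
    assume q: "q \<in> binary_cubics"
    have sub: "Poly_Mapping.keys q \<subseteq> cubic_expo ` {..3}"
    proof
      fix m assume "m \<in> Poly_Mapping.keys q"
      then have m3: "Poly_Mapping.lookup m 1 + Poly_Mapping.lookup m 2 = 3"
        using q by (auto simp: binary_cubics_def sum_2)
      have "m = cubic_expo (Poly_Mapping.lookup m 2)"
      proof (rule poly_mapping_eqI)
        fix i :: 2
        show "Poly_Mapping.lookup m i = Poly_Mapping.lookup (cubic_expo (Poly_Mapping.lookup m 2)) i"
          using exhaust_2 [of i] m3 lookup_cubic_expo [of "Poly_Mapping.lookup m 2"] by fastforce
      qed
      then show "m \<in> cubic_expo ` {..3}"
        using m3 by (metis atMost_iff image_eqI le_add2)
    qed
    have "q = (\<Sum>m\<in>cubic_expo ` {..3}. Poly_Mapping.single m (Poly_Mapping.lookup q m))"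
    proof (rule poly_mapping_eqI)
      fix k
      show "Poly_Mapping.lookup q k = Poly_Mapping.lookup
          (\<Sum>m\<in>cubic_expo ` {..3}. Poly_Mapping.single m (Poly_Mapping.lookup q m)) k"
        using sub by (auto simp: lookup_sum lookup_single when_def in_keys_iff)
    qed
    also have "\<dots> = (\<Sum>j\<le>3. Const (cubic_coeff q j) * cubic_monom j)"
      by (simp add: sum.reindex [OF inj] sum_eq cubic_coeff_def)
    finally show "\<exists>a. q = (\<Sum>j\<le>3. Const (a j) * cubic_monom j)" by blast
  next
    assume "\<exists>a. q = (\<Sum>j\<le>3. Const (a j) * cubic_monom j)"
    then obtain a where q: "q = (\<Sum>j\<le>3. Poly_Mapping.single (cubic_expo j) (a j))"
      using sum_eq by metis
    have "\<exists>j\<le>3. m = cubic_expo j" if "m \<in> Poly_Mapping.keys q" for m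
    proof (rule ccontr)
      assume "\<not> (\<exists>j\<le>3. m = cubic_expo j)"
      then have "Poly_Mapping.lookup q m = 0"
        by (auto simp: q lookup_sum lookup_single when_def intro!: sum.neutral)
      with that show False by (simp add: in_keys_iff)
    qed
    then show "q \<in> binary_cubics"
      by (fastforce simp: binary_cubics_def sum_2 lookup_cubic_expo)
  qed
qed

text \<open>The discriminant, as a polynomial in the coefficients \<open>a\<^sub>0, \<dots>, a\<^sub>3\<close>; here \<open>a\<^sub>j\<close> is \<open>Var j\<close>.\<close>

definition cubic_disc :: "(nat, 'a::comm_ring_1) mpoly" where
  "cubic_disc =
     Var 1 ^ 2 * Var 2 ^ 2 + 18 * Var 0 * Var 1 * Var 2 * Var 3
     - 4 * Var 0 * Var 2 ^ 3 - 4 * Var 1 ^ 3 * Var 3 - 27 * Var 0 ^ 2 * Var 3 ^ 2"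

definition cubic_linear :: "((2, 'a::comm_ring_1) mpoly \<Rightarrow> (2, 'a) mpoly) \<Rightarrow> bool" where
  "cubic_linear \<phi> \<longleftrightarrow>
     (\<forall>q\<in>binary_cubics. \<phi> q \<in> binary_cubics) \<and>
     (\<forall>p\<in>binary_cubics. \<forall>q\<in>binary_cubics. \<phi> (p + q) = \<phi> p + \<phi> q) \<and>
     (\<forall>c. \<forall>q\<in>binary_cubics. \<phi> (Const c * q) = Const c * \<phi> q)"

text \<open>The \<open>i\<close>-th coefficient of the image under \<open>\<phi>\<close> of the form with coefficients
  \<open>a\<^sub>0, \<dots>, a\<^sub>3\<close>, as a linear polynomial in those coefficients.\<close>

definition cubic_coord ::
    "((2, 'a::comm_ring_1) mpoly \<Rightarrow> (2, 'a) mpoly) \<Rightarrow> nat \<Rightarrow> (nat, 'a) mpoly" where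
  "cubic_coord \<phi> i = (\<Sum>j\<le>3. Const (cubic_coeff (\<phi> (cubic_monom j)) i) * Var j)"

text \<open>This is an identity of formal polynomials; over a finite field it is a priori stronger than
  equality of the discriminants of \<open>\<phi> q\<close> and \<open>q\<close> for every \<open>q\<close>.\<close>

definition preserves_disc :: "((2, 'a::comm_ring_1) mpoly \<Rightarrow> (2, 'a) mpoly) \<Rightarrow> bool" where
  "preserves_disc \<phi> \<longleftrightarrow> mp_subst (cubic_coord \<phi>) cubic_disc = cubic_disc"

text \<open>\<open>q \<circ> g\<close> for a matrix \<open>g\<close> acting on column vectors.\<close>

definition form_comp :: "(2, 'a::comm_ring_1) mpoly \<Rightarrow> 'a ^ 2 ^ 2 \<Rightarrow> (2, 'a) mpoly" where
  "form_comp q g = mp_subst (\<lambda>i. \<Sum>j\<in>UNIV. Const (g $ i $ j) * Var j) q"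

end

theory Submission
  imports Defs
begin

text \<open>
  Let \<open>A\<close> be the matrix of \<open>\<phi>\<close>. The differential of the discriminant commutes with \<open>A\<close>. It
  vanishes exactly at the forms \<open>k l\<^sup>3\<close> with \<open>l\<close> linear, and \<open>A\<close> is injective because the partial
  derivatives are linearly independent. So \<open>A\<close> maps \<open>x\<^sup>3\<close> and \<open>y\<^sup>3\<close> to multiples of cubes of two
  independent linear forms. After a substitution, which multiplies the discriminant by a constant
  \<open>s\<close>, both \<open>x\<^sup>3\<close> and \<open>y\<^sup>3\<close> are eigenvectors; comparing coefficients of the discriminant then makes
  the matrix diagonal, and its entries are those of a multiple of a diagonal substitution.
\<close>

section \<open>Cubic forms as coefficient vectors: discriminant and substitutions\<close>

lemma vector_4 [simp]:
  "(vector [a, b, c, d] :: 'a::zero ^ 4) $ 1 = a" "(vector [a, b, c, d] :: 'a ^ 4) $ 2 = b"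
  "(vector [a, b, c, d] :: 'a ^ 4) $ 3 = c" "(vector [a, b, c, d] :: 'a ^ 4) $ 4 = d"
  unfolding vector_def by simp_all

text \<open>A vector \<open>v\<close> stands for the form with \<open>a\<^sub>j\<close> the component of index \<open>j + 1\<close>, and \<open>act g v\<close> lists the
  coefficients of that form composed with \<open>g\<close>.\<close>

definition disc :: "'a::comm_ring_1 ^ 4 \<Rightarrow> 'a" where
  "disc v = (v$2)^2 * (v$3)^2 + 18 * v$1 * v$2 * v$3 * v$4 - 4 * v$1 * (v$3)^3
     - 4 * (v$2)^3 * v$4 - 27 * (v$1)^2 * (v$4)^2"

definition disc_deriv :: "'a::comm_ring_1 ^ 4 \<Rightarrow> 'a ^ 4 \<Rightarrow> 'a" where
  "disc_deriv v w =
     (18 * v$2 * v$3 * v$4 - 4 * (v$3)^3 - 54 * v$1 * (v$4)^2) * w$1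
   + (2 * v$2 * (v$3)^2 + 18 * v$1 * v$3 * v$4 - 12 * (v$2)^2 * v$4) * w$2
   + (2 * (v$2)^2 * v$3 + 18 * v$1 * v$2 * v$4 - 12 * v$1 * (v$3)^2) * w$3
   + (18 * v$1 * v$2 * v$3 - 4 * (v$2)^3 - 54 * (v$1)^2 * v$4) * w$4"

definition act :: "'a::comm_ring_1 ^ 2 ^ 2 \<Rightarrow> 'a ^ 4 \<Rightarrow> 'a ^ 4" where
  "act g v = (let a = g$1$1; b = g$1$2; c = g$2$1; d = g$2$2 in
     vector
      [v$1 * a^3 + v$2 * a^2 * c + v$3 * a * c^2 + v$4 * c^3,
       3 * v$1 * a^2 * b + v$2 * (a^2 * d + 2 * a * b * c) + v$3 * (2 * a * c * d + b * c^2) + 3 * v$4 * c^2 * d,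
       3 * v$1 * a * b^2 + v$2 * (b^2 * c + 2 * a * b * d) + v$3 * (a * d^2 + 2 * b * c * d) + 3 * v$4 * c * d^2,
       v$1 * b^3 + v$2 * b^2 * d + v$3 * b * d^2 + v$4 * d^3])"

text \<open>The coefficients of \<open>(a x + b y)^3\<close>.\<close>

definition cube :: "'a::comm_ring_1 \<Rightarrow> 'a \<Rightarrow> 'a ^ 4" where
  "cube a b = vector [a^3, 3 * a^2 * b, 3 * a * b^2, b^3]"

text \<open>The five-point difference formula is exact on polynomials of degree at most 4. It recovers the
  derivative from values, so no formal differentiation of \<open>disc (A *v v)\<close> is needed.\<close>

lemma disc_deriv_difference:
  fixes v w :: "'a::idom ^ 4"
  shows "12 * disc_deriv v w = 8 * (disc (v + w) - disc (v - w)) - (disc (v + 2 *s w) - disc (v - 2 *s w))"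
  unfolding disc_def disc_deriv_def by (simp; algebra)

lemma disc_act:
  fixes v :: "'a::idom ^ 4"
  shows "disc (act g v) = det g ^ 6 * disc v"
  unfolding disc_def act_def by (simp add: Let_def det_2; algebra)

text \<open>Substitution is a right action: composing with \<open>h\<close> and then with
  \<open>g\<close> is composing with the product \<open>h ** g\<close>.\<close>

lemma act_act:
  fixes v :: "'a::idom ^ 4"
  shows "act g (act h v) = act (h ** g) v"
  unfolding act_def by (simp add: Let_def vec_eq_iff forall_4 matrix_matrix_mult_def sum_2; algebra)

section \<open>Critical points of the discriminant under linear maps\<close>

lemma smooth_numerals_nonzero:
  assumes "(2::'a::idom) \<noteq> 0" and "(3::'a) \<noteq> 0"
  shows "(4::'a) \<noteq> 0" "(12::'a) \<noteq> 0" "(18::'a) \<noteq> 0" "(27::'a) \<noteq> 0" "(108::'a) \<noteq> 0"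
proof -
  have "(4::'a) = 2 * 2" "(12::'a) = 2 * 2 * 3" "(18::'a) = 2 * 3 * 3" "(27::'a) = 3 * 3 * 3"
    "(108::'a) = 2 * 2 * 3 * 3 * 3"
    by simp_all
  then show "(4::'a) \<noteq> 0" "(12::'a) \<noteq> 0" "(18::'a) \<noteq> 0" "(27::'a) \<noteq> 0" "(108::'a) \<noteq> 0"
    using assms by (metis mult_eq_0_iff)+
qed

text \<open>The five-point formula involves only values of \<open>disc\<close> at combinations of
  \<open>v\<close> and \<open>w\<close>, which \<open>A\<close> respects. The factor
  \<open>s\<close> allows for maps already composed with a substitution.\<close>

lemma disc_deriv_preserved:
  fixes A :: "'a::field ^ 4 ^ 4"
  assumes "(2::'a) \<noteq> 0" and "(3::'a) \<noteq> 0"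
    and "\<And>v. disc (A *v v) = s * disc v"
  shows "disc_deriv (A *v v) (A *v w) = s * disc_deriv v w"
proof -
  have "(12::'a) \<noteq> 0"
    using smooth_numerals_nonzero[OF assms(1,2)] by simp
  moreover have "12 * disc_deriv (A *v v) (A *v w) = 12 * (s * disc_deriv v w)"
  proof -
    have "12 * disc_deriv (A *v v) (A *v w) =
        8 * (disc (A *v (v + w)) - disc (A *v (v - w)))
        - (disc (A *v (v + 2 *s w)) - disc (A *v (v - 2 *s w)))"
      unfolding disc_deriv_difference
      by (simp add: matrix_vector_right_distrib matrix_vector_mult_diff_distrib
          vector_scalar_commute)
    also have "\<dots> = s * (12 * disc_deriv v w)"
      unfolding disc_deriv_difference assms(3) by (simp add: algebra_simps)
    finally show ?thesis by simp
  qed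
  ultimately show ?thesis by simp
qed

text \<open>Without an \<open>x^3\<close> term, the vanishing derivatives leave only
  \<open>y^3\<close>. With one, they annihilate the lower terms that remain after completing the
  cube.\<close>

lemma disc_deriv_eq_0_imp_cube:
  fixes v :: "'a::field ^ 4"
  assumes two: "(2::'a) \<noteq> 0" and three: "(3::'a) \<noteq> 0"
    and deriv: "\<And>w. disc_deriv v w = 0"
  obtains k a b where "v = k *s cube a b"
proof -
  note nz = smooth_numerals_nonzero[OF two three]
  have d1: "18 * v$2 * v$3 * v$4 - 4 * (v$3)^3 - 54 * v$1 * (v$4)^2 = 0"
    using deriv[of "axis 1 1"] by (simp add: disc_deriv_def axis_def)
  have d3: "2 * (v$2)^2 * v$3 + 18 * v$1 * v$2 * v$4 - 12 * v$1 * (v$3)^2 = 0"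
    using deriv[of "axis 3 1"] by (simp add: disc_deriv_def axis_def)
  have d4: "18 * v$1 * v$2 * v$3 - 4 * (v$2)^3 - 54 * (v$1)^2 * v$4 = 0"
    using deriv[of "axis 4 1"] by (simp add: disc_deriv_def axis_def)
  show thesis
  proof (cases "v$1 = 0")
    case True
    then have "v$2 = 0"
      using d4 nz by simp
    then have "v$3 = 0"
      using d1 True nz by simp
    then show thesis
      using True \<open>v$2 = 0\<close> that[of "v$4" 0 1] by (simp add: vec_eq_iff forall_4 cube_def)
  next
    case False
    \<comment> \<open>Up to nonzero factors, \<open>R\<close> and \<open>3 a\<^sub>0 a\<^sub>2 - a\<^sub>1\<^sup>2\<close> are the coefficients of the depressed cubic.\<close>
    define R where "R = 27 * (v$1)^2 * v$4 - 9 * v$1 * v$2 * v$3 + 2 * (v$2)^3"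
    have "2 * R = 0"
      using d4 unfolding R_def by algebra
    then have R: "R = 0"
      using two by simp
    \<comment> \<open>This combination of \<open>R\<close> and the third partial derivative cancels
      \<open>v$4\<close> and leaves a square.\<close>
    have "4 * (3 * v$1 * v$3 - (v$2)^2)^2 = 2 * v$2 * R - 3 * v$1 *
        (2 * (v$2)^2 * v$3 + 18 * v$1 * v$2 * v$4 - 12 * v$1 * (v$3)^2)"
      unfolding R_def by algebra
    then have P: "3 * v$1 * v$3 = (v$2)^2"
      using R d3 nz by simp
    have Q: "27 * (v$1)^2 * v$4 = (v$2)^3"
      using R P unfolding R_def by algebra
    \<comment> \<open>The shift that completes the cube: the form will be \<open>v$1\<close> times
      \<open>(x + t y)^3\<close>.\<close>
    define t where "t = v$2 / (3 * v$1)"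
    have v2: "v$2 = 3 * v$1 * t"
      unfolding t_def using False three by simp
    have "3 * v$1 * (v$3) = 3 * v$1 * (3 * v$1 * t^2)"
      using P unfolding v2 by algebra
    then have v3: "v$3 = 3 * v$1 * t^2"
      using False three by (metis mult_cancel_left mult_eq_0_iff)
    have "27 * (v$1)^2 * v$4 = 27 * (v$1)^2 * (v$1 * t^3)"
      using Q unfolding v2 by algebra
    then have v4: "v$4 = v$1 * t^3"
      using False nz by simp
    show thesis
      by (rule that[of "v$1" 1 t]) (simp_all add: vec_eq_iff forall_4 cube_def v2 v3 v4)
  qed
qed

text \<open>Along a kernel vector the differential vanishes at every point, which is a linear
  relation between the four partial derivatives.\<close>

lemma disc_preserving_injective:
  fixes A :: "'a::field ^ 4 ^ 4"
  assumes two: "(2::'a) \<noteq> 0" and three: "(3::'a) \<noteq> 0"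
    and disc: "\<And>v. disc (A *v v) = disc v" and "A *v v = 0"
  shows "v = 0"
proof -
  note nz = smooth_numerals_nonzero[OF two three]
  have D: "disc_deriv u v = 0" for u
  proof -
    have "disc_deriv u v = disc_deriv (A *v u) (A *v v)"
      using disc_deriv_preserved[OF two three, of A 1] disc by simp
    then show ?thesis
      using assms(4) by (simp add: disc_deriv_def)
  qed
  \<comment> \<open>At each test point a single partial derivative is nonzero, apart from those
    paired with components of \<open>v\<close> already shown to vanish.\<close>
  have "v$1 = 0"
    using D[of "vector [0,0,1,0]"] nz by (simp add: disc_deriv_def)
  moreover have "v$4 = 0"
    using D[of "vector [0,1,0,0]"] nz by (simp add: disc_deriv_def)
  moreover have "v$3 = 0"
    using D[of "vector [1,0,1,0]"] nz \<open>v$1 = 0\<close> by (simp add: disc_deriv_def)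
  moreover have "v$2 = 0"
    using D[of "vector [0,1,0,1]"] nz \<open>v$4 = 0\<close> by (simp add: disc_deriv_def)
  ultimately show ?thesis
    by (simp add: vec_eq_iff forall_4)
qed

text \<open>An injective square matrix is surjective, so every direction at \<open>A *v u\<close> is
  the image of a direction at \<open>u\<close>, and criticality is passed on.\<close>

lemma image_of_critical_is_cube:
  fixes A :: "'a::field ^ 4 ^ 4"
  assumes two: "(2::'a) \<noteq> 0" and three: "(3::'a) \<noteq> 0"
    and disc: "\<And>v. disc (A *v v) = disc v" and crit: "\<And>w. disc_deriv u w = 0"
  obtains k a b where "A *v u = k *s cube a b"
proof -
  have "inj ((*v) A)"
  proof (rule injI)
    fix v w assume "A *v v = A *v w"
    then have "A *v (v - w) = 0"
      by (simp add: matrix_vector_mult_diff_distrib)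
    then show "v = w"
      using disc_preserving_injective[OF two three disc] by fastforce
  qed
  then obtain B where "B ** A = mat 1"
    using matrix_left_invertible_injective by blast
  then have AB: "A ** B = mat 1"
    by (simp add: matrix_left_right_inverse)
  have "disc_deriv (A *v u) w = 0" for w
  proof -
    have "w = A *v (B *v w)"
      using AB by (simp add: matrix_vector_mul_assoc)
    then show ?thesis
      using disc_deriv_preserved[OF two three, of A 1 u "B *v w"] disc crit by simp
  qed
  then show thesis
    using disc_deriv_eq_0_imp_cube[OF two three] that by blast
qed

section \<open>Maps with eigenvectors \<open>x^3\<close> and \<open>y^3\<close>\<close>

text \<open>Testing at sparse forms removes the off-diagonal entries. The relations left between the
  diagonal entries \<open>c, q, r, d\<close> make them a geometric progression, which is how a
  multiple of a diagonal substitution acts.\<close>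

lemma diagonal_of_preserves_cubes:
  fixes N :: "'a::field ^ 4 ^ 4"
  assumes two: "(2::'a) \<noteq> 0" and three: "(3::'a) \<noteq> 0" and "s \<noteq> 0"
    and disc: "\<And>v. disc (N *v v) = s * disc v"
    and N1: "N *v axis 1 1 = c *s axis 1 1" and N4: "N *v axis 4 1 = d *s axis 4 1"
  obtains a where "a \<noteq> 0" and "d \<noteq> 0"
    and "\<And>v. N *v v = d *s act (vector [vector [a, 0], vector [0, 1]]) v"
proof -
  note nz = smooth_numerals_nonzero[OF two three]
  have col1: "N$1$1 = c" "N$2$1 = 0" "N$3$1 = 0" "N$4$1 = 0"
    and col4: "N$1$4 = 0" "N$2$4 = 0" "N$3$4 = 0" "N$4$4 = d"
    using N1 N4 by (simp_all add: vec_eq_iff forall_4 axis_def matrix_vector_mult_def sum_4)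
  note D = disc_deriv_preserved[OF two three disc]
  note ev = disc_deriv_def disc_def matrix_vector_mult_def sum_4 axis_def col1 col4
  have cd: "(c * d)^2 = s"
  proof -
    have "27 * (c * d)^2 = 27 * s"
      using disc[of "vector [1,0,0,1]"] by (simp add: ev power_mult_distrib)
    then show ?thesis using nz by simp
  qed
  have c0: "c \<noteq> 0" and d0: "d \<noteq> 0"
    using cd \<open>s \<noteq> 0\<close> by auto
  \<comment> \<open>At \<open>x^3 + y^3\<close> and \<open>x^3 - y^3\<close> the differential sees
    only the outer components; the sum and difference of the two relations separate the two
    entries.\<close>
  have outer: "N$1$j = 0 \<and> N$4$j = 0" if "j = 2 \<or> j = 3" for j
  proof -
    have e: "54 * c * d^2 * N$1$j + 54 * c^2 * d * N$4$j = 0"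
      using D[of "vector [1,0,0,1]" "axis j 1"] that by (auto simp: ev algebra_simps)
    have f: "54 * c * d^2 * N$1$j - 54 * c^2 * d * N$4$j = 0"
      using D[of "vector [1,0,0,-1]" "axis j 1"] that by (auto simp: ev algebra_simps)
    have "108 * c * d^2 * N$1$j = 0"
      using e f by algebra
    moreover have "108 * c^2 * d * N$4$j = 0"
      using e f by algebra
    ultimately show ?thesis
      using c0 d0 nz by simp
  qed
  then have o: "N$1$2 = 0" "N$4$2 = 0" "N$1$3 = 0" "N$4$3 = 0"
    by blast+
  define q where "q = N$2$2"
  define r where "r = N$3$3"
  \<comment> \<open>This isolates the term \<open>a0 a2^3\<close> of the discriminant;
    \<open>qr\<close> below isolates \<open>a1^2 a2^2\<close>.\<close>
  have cr: "c * r^3 = s"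
    using D[of "axis 3 1" "axis 1 1"] nz by (simp add: ev o r_def mult.commute)
  have N32: "N$3$2 = 0"
    using D[of "axis 2 1" "axis 1 1"] nz c0 by (simp add: ev o)
  have N23: "N$2$3 = 0"
    using D[of "axis 3 1" "axis 4 1"] nz d0 by (simp add: ev o)
  have qr: "q^2 * r^2 = s"
    using disc[of "vector [0,1,1,0]"] by (simp add: ev o N32 N23 q_def r_def)
  have cdqr: "c * d * q * r = s"
  proof -
    \<comment> \<open>Here \<open>14 = 18 - 4\<close>, from the terms \<open>a0 a1 a2 a3\<close> and
      \<open>a0 a2^3\<close>; the second is known from \<open>cr\<close>.\<close>
    have "c * (18 * q * r * d - 4 * r^3) = 14 * s"
      using D[of "vector [0,1,1,1]" "axis 1 1"]
      by (simp add: ev o N32 N23 q_def r_def algebra_simps)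
    then have "18 * (c * d * q * r) = 18 * s"
      using cr by algebra
    then show ?thesis using nz by simp
  qed
  have r0: "r \<noteq> 0" and q0: "q \<noteq> 0"
    using qr \<open>s \<noteq> 0\<close> by auto
  have rr: "r^2 = d * q"
  proof -
    have "(c * r) * r^2 = (c * r) * (d * q)"
      using cr cdqr by (simp add: power2_eq_square power3_eq_cube mult_ac)
    then show ?thesis using c0 r0 by simp
  qed
  have "q * r = c * d"
  proof -
    have "(q * r) * (q * r) = (q * r) * (c * d)"
      using qr cdqr by (simp add: power2_eq_square mult_ac)
    then show ?thesis using q0 r0 by (metis mult_cancel_left mult_eq_0_iff)
  qed
  then have rrr: "r^3 = c * d^2"
    using rr by algebra
  show thesis
  \<comment> \<open>The ratio of the progression: the substitution \<open>x\<close> to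
    \<open>a x\<close> scales the coefficients by \<open>a^3, a^2, a, 1\<close>.\<close>
  proof (rule that[of "r / d"])
    show "r / d \<noteq> 0" "d \<noteq> 0"
      using r0 d0 by simp_all
    show "N *v v = d *s act (vector [vector [r / d, 0], vector [0, 1]]) v" for v
    proof -
      have "c = d * (r / d)^3" "q = d * (r / d)^2" "r = d * (r / d)"
        using d0 rr rrr by (simp_all add: power_divide field_simps power2_eq_square power3_eq_cube)
      then show ?thesis
        unfolding act_def Let_def
        using d0 by (simp add: vec_eq_iff forall_4 ev o N32 N23 flip: q_def r_def)
    qed
  qed
qed

section \<open>Reduction to the diagonal case by a substitution\<close>

lemma act_scale:
  "act g (k *s v) = k *s act g v"
  by (simp add: act_def Let_def vec_eq_iff forall_4 algebra_simps)

lemma matrix_act: "matrix (act g) *v v = act g v"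
  by (simp add: matrix_def act_def Let_def vec_eq_iff forall_4 matrix_vector_mult_def sum_4
      axis_def mult.commute)

lemma act_scalar_matrix: "act (vector [vector [t, 0], vector [0, t]]) v = t^3 *s v"
  by (simp add: act_def Let_def vec_eq_iff forall_4 power3_eq_cube power2_eq_square mult_ac)

lemma act_cube:
  fixes a :: "'a::idom"
  shows "act h (cube a b) = cube (a * h$1$1 + b * h$2$1) (a * h$1$2 + b * h$2$2)"
  unfolding act_def cube_def by (simp add: Let_def vec_eq_iff forall_4; algebra)

lemma disc_scale: "disc (k *s v) = k^4 * disc v"
  by (simp add: disc_def power2_eq_square power3_eq_cube power4_eq_xxxx algebra_simps)

lemma disc_preserving_matrix:
  fixes A :: "'a::field ^ 4 ^ 4"
  assumes two: "(2::'a) \<noteq> 0" and three: "(3::'a) \<noteq> 0"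
    and disc: "\<And>v. disc (A *v v) = disc v"
  obtains c g where "c \<noteq> 0" and "det g \<noteq> 0" and "c ^ 4 * det g ^ 6 = 1"
    and "\<And>v. A *v v = c *s act g v"
proof -
  note inj = disc_preserving_injective[OF two three disc]
  obtain k a b where Ax: "A *v axis 1 1 = k *s cube a b"
    by (rule image_of_critical_is_cube[OF two three disc, of "axis 1 1"])
      (simp_all add: disc_deriv_def axis_def)
  obtain l c d where Ay: "A *v axis 4 1 = l *s cube c d"
    by (rule image_of_critical_is_cube[OF two three disc, of "axis 4 1"])
      (simp_all add: disc_deriv_def axis_def)
  define D where "D = a * d - b * c"
  have "D \<noteq> 0"
  proof
    assume "D = 0"
    then have dep: "a * d = b * c" by (simp add: D_def)
    have lin: "A *v (s *s axis 1 1 - t *s axis 4 1) = s *s (k *s cube a b) - t *s (l *s cube c d)" for s t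
      by (simp add: matrix_vector_mult_diff_distrib vector_scalar_commute Ax Ay)
    \<comment> \<open>Since \<open>(c a, c b) = (a c, a d)\<close>, the scaled cubes in the image
      coincide and cancel.\<close>
    have "A *v ((l * c^3) *s axis 1 1 - (k * a^3) *s axis 4 1) = 0"
      unfolding lin using dep by (simp add: cube_def vec_eq_iff forall_4) algebra
    from inj[OF this] have "k * a^3 = 0"
      by (simp add: vec_eq_iff forall_4 axis_def)
    moreover have "A *v ((l * d^3) *s axis 1 1 - (k * b^3) *s axis 4 1) = 0"
      unfolding lin using dep by (simp add: cube_def vec_eq_iff forall_4) algebra
    from inj[OF this] have "k * b^3 = 0"
      by (simp add: vec_eq_iff forall_4 axis_def)
    ultimately have "A *v axis 1 1 = 0"
      unfolding Ax by (auto simp: cube_def vec_eq_iff forall_4)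
    from inj[OF this] show False
      by (simp add: vec_eq_iff forall_4 axis_def)
  qed
  define g :: "'a ^ 2 ^ 2" where "g = vector [vector [a, b], vector [c, d]]"
  \<comment> \<open>The adjugate of \<open>g\<close> replaces its inverse to avoid denominators.\<close>
  define h :: "'a ^ 2 ^ 2" where "h = vector [vector [d, - b], vector [- c, a]]"
  have hg: "h ** g = vector [vector [D, 0], vector [0, D]]"
    by (simp add: h_def g_def D_def vec_eq_iff forall_2 matrix_matrix_mult_def sum_2 algebra_simps)
  \<comment> \<open>Composing with \<open>h\<close> turns \<open>a x + b y\<close> and
    \<open>c x + d y\<close> into \<open>D x\<close> and \<open>D y\<close>, so \<open>N\<close> has
    eigenvectors \<open>x^3\<close> and \<open>y^3\<close>.\<close>
  define N where "N = matrix (act h) ** A"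
  have N: "N *v v = act h (A *v v)" for v
    by (simp add: N_def matrix_act flip: matrix_vector_mul_assoc)
  have "disc (N *v v) = D^6 * disc v" for v
    by (simp add: N disc_act disc h_def D_def det_2 mult.commute)
  moreover have "N *v axis 1 1 = (k * D^3) *s axis 1 1"
    by (simp add: N Ax act_scale act_cube)
      (simp add: cube_def h_def D_def axis_def vec_eq_iff forall_4 mult.commute)
  moreover have "N *v axis 4 1 = (l * D^3) *s axis 4 1"
    by (simp add: N Ay act_scale act_cube)
      (simp add: cube_def h_def D_def axis_def vec_eq_iff forall_4 mult.commute)
  moreover have "D^6 \<noteq> 0"
    using \<open>D \<noteq> 0\<close> by simp
  ultimately obtain t where "t \<noteq> 0" and "l * D^3 \<noteq> 0"
    and diag: "\<And>v. N *v v = (l * D^3) *s act (vector [vector [t, 0], vector [0, 1]]) v"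
    using diagonal_of_preserves_cubes[OF two three] by metis
  define G :: "'a ^ 2 ^ 2" where "G = vector [vector [t, 0], vector [0, 1]] ** g"
  have "det G = t * D"
    by (simp add: G_def det_mul) (simp add: det_2 g_def D_def)
  have A: "A *v v = l *s act G v" for v
  proof -
    \<comment> \<open>Substituting \<open>g\<close> undoes \<open>h\<close> up to the scalar matrix
      \<open>D\<close>, which acts on cubics as \<open>D^3\<close>.\<close>
    have "D^3 *s (A *v v) = act g (N *v v)"
      by (simp add: N act_act hg act_scalar_matrix)
    also have "\<dots> = D^3 *s (l *s act G v)"
      by (simp add: diag act_scale act_act G_def mult.commute)
    finally show ?thesis
      using \<open>D \<noteq> 0\<close> by (simp add: vec_eq_iff)
  qed
  show thesis
  proof (rule that[of l G])
    show "l \<noteq> 0" "det G \<noteq> 0"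
      using \<open>l * D^3 \<noteq> 0\<close> \<open>t \<noteq> 0\<close> \<open>D \<noteq> 0\<close> \<open>det G = t * D\<close> by auto
    \<comment> \<open>The form \<open>x^3 + y^3\<close> has discriminant \<open>-27\<close>, which
      can be cancelled.\<close>
    let ?v = "vector [1, 0, 0, 1] :: 'a ^ 4"
    have "disc ?v = l^4 * (det G ^ 6 * disc ?v)"
      using disc[of ?v] by (simp add: A disc_scale disc_act)
    moreover have "disc ?v \<noteq> 0"
      using smooth_numerals_nonzero[OF two three] by (simp add: disc_def)
    ultimately show "l ^ 4 * det G ^ 6 = 1"
      by simp
  qed (rule A)
qed

section \<open>Substitution as a homomorphism of formal polynomials\<close>

lemma Const_hom:
  fixes a b :: "'a::comm_ring_1"
  shows "Const (a + b) = Const a + Const b" "Const (a * b) = Const a * Const b"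
    "Const (a - b) = Const a - Const b"
    "Const 0 = 0" "Const 1 = 1" "Const (numeral k) = numeral k" "Const (a ^ n) = Const a ^ n"
proof -
  show "Const (a + b) = Const a + Const b" and mult: "Const (a * b) = Const a * Const b" for a b :: 'a
    by (simp_all add: Const_def single_add mult_single)
  show "Const (a - b) = Const a - Const b"
    by (simp add: Const_def single_diff)
  show "Const 0 = 0" and one: "Const 1 = 1" "Const (numeral k) = numeral k"
    by (simp_all add: Const_def single_one single_numeral)
  show "Const (a ^ n) = Const a ^ n"
    by (induction n) (simp_all add: mult one)
qed

lemma Const_inject [simp]: "Const a = Const b \<longleftrightarrow> a = b"
  unfolding Const_def by (metis lookup_single_eq)

text \<open>Cancellation can shrink the keys of a sum; a common larger index set makes additivity a
  termwise matter.\<close>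

lemma mp_subst_superset:
  assumes "finite S" and "Poly_Mapping.keys p \<subseteq> S"
  shows "mp_subst \<sigma> p = (\<Sum>m\<in>S. Const (Poly_Mapping.lookup p m) *
     (\<Prod>i\<in>Poly_Mapping.keys m. \<sigma> i ^ Poly_Mapping.lookup m i))"
  unfolding mp_subst_def using assms
  by (intro sum.mono_neutral_left) (auto simp: in_keys_iff Const_hom)

lemma mp_subst_add: "mp_subst \<sigma> (p + q) = mp_subst \<sigma> p + mp_subst \<sigma> q"
proof -
  have "Poly_Mapping.keys (p + q) \<subseteq> Poly_Mapping.keys p \<union> Poly_Mapping.keys q"
    by (rule keys_add)
  then show ?thesis
    by (simp add: mp_subst_superset[of "Poly_Mapping.keys p \<union> Poly_Mapping.keys q"]
        lookup_add Const_hom distrib_right sum.distrib)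
qed

lemma mp_subst_single:
  "mp_subst \<sigma> (Poly_Mapping.single m c) =
     Const c * (\<Prod>i\<in>Poly_Mapping.keys m. \<sigma> i ^ Poly_Mapping.lookup m i)"
  by (subst mp_subst_superset[of "{m}"]) auto

lemma mp_subst_sum: "mp_subst \<sigma> (\<Sum>x\<in>S. f x) = (\<Sum>x\<in>S. mp_subst \<sigma> (f x))"
proof (induction S rule: infinite_finite_induct)
qed (simp_all add: mp_subst_add, simp_all add: mp_subst_def)

lemma monomial_value_add:
  fixes \<sigma> :: "'v \<Rightarrow> 'b::comm_semiring_1"
  shows "(\<Prod>i\<in>Poly_Mapping.keys (m + n). \<sigma> i ^ Poly_Mapping.lookup (m + n) i) =
    (\<Prod>i\<in>Poly_Mapping.keys m. \<sigma> i ^ Poly_Mapping.lookup m i) *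
    (\<Prod>i\<in>Poly_Mapping.keys n. \<sigma> i ^ Poly_Mapping.lookup n i)"
proof -
  let ?S = "Poly_Mapping.keys m \<union> Poly_Mapping.keys n"
  have "(\<Prod>i\<in>Poly_Mapping.keys k. \<sigma> i ^ Poly_Mapping.lookup k i) =
      (\<Prod>i\<in>?S. \<sigma> i ^ Poly_Mapping.lookup k i)" if "Poly_Mapping.keys k \<subseteq> ?S" for k
    using that by (intro prod.mono_neutral_left) (auto simp: in_keys_iff)
  from this[of m] this[of n] this[OF keys_add] show ?thesis
    by (simp add: lookup_add power_add prod.distrib)
qed

lemma sum_single_lookup:
  "(\<Sum>m\<in>Poly_Mapping.keys p. Poly_Mapping.single m (Poly_Mapping.lookup p m)) = p"
  by (rule poly_mapping_eqI) (auto simp: lookup_sum lookup_single when_def in_keys_iff)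

text \<open>Both sides are additive in each factor, so products of single monomials decide.\<close>

lemma mp_subst_mult: "mp_subst \<sigma> (p * q) = mp_subst \<sigma> p * mp_subst \<sigma> q"
proof -
  have "mp_subst \<sigma> (Poly_Mapping.single m a * Poly_Mapping.single n b) =
      mp_subst \<sigma> (Poly_Mapping.single m a) * mp_subst \<sigma> (Poly_Mapping.single n b)" for m n a b
    by (simp add: mult_single mp_subst_single monomial_value_add Const_hom mult_ac)
  then have "mp_subst \<sigma>
        ((\<Sum>m\<in>Poly_Mapping.keys p. Poly_Mapping.single m (Poly_Mapping.lookup p m)) *
         (\<Sum>n\<in>Poly_Mapping.keys q. Poly_Mapping.single n (Poly_Mapping.lookup q n))) =
      mp_subst \<sigma> (\<Sum>m\<in>Poly_Mapping.keys p. Poly_Mapping.single m (Poly_Mapping.lookup p m)) *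
      mp_subst \<sigma> (\<Sum>n\<in>Poly_Mapping.keys q. Poly_Mapping.single n (Poly_Mapping.lookup q n))"
    by (simp only: sum_product mp_subst_sum)
  then show ?thesis
    by (simp only: sum_single_lookup)
qed

lemma mp_subst_Const: "mp_subst \<sigma> (Const c) = Const c"
  by (subst Const_def) (simp add: mp_subst_single)

lemma mp_subst_Var: "mp_subst \<sigma> (Var i) = \<sigma> i"
  by (simp add: Var_def mp_subst_single Const_hom)

lemma mp_subst_numeral: "mp_subst \<sigma> (numeral n) = numeral n"
  using mp_subst_Const[of \<sigma> "numeral n"] by (simp add: Const_hom)

lemma mp_subst_diff: "mp_subst \<sigma> (p - q) = mp_subst \<sigma> p - mp_subst \<sigma> q"
  using mp_subst_add[of \<sigma> "p - q" q] by simp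

lemma mp_subst_power: "mp_subst \<sigma> (p ^ n) = mp_subst \<sigma> p ^ n"
  by (induction n) (simp_all add: mp_subst_mult, metis Const_hom(5) mp_subst_Const)

lemmas mp_subst_hom = mp_subst_add mp_subst_diff mp_subst_mult mp_subst_power mp_subst_sum
  mp_subst_numeral mp_subst_Const mp_subst_Var

section \<open>Translation between formal cubics and coefficient vectors\<close>

definition form :: "'a::comm_ring_1 ^ 4 \<Rightarrow> (2, 'a) mpoly" where
  "form v = Const (v$1) * cubic_monom 0 + Const (v$2) * cubic_monom 1
     + Const (v$3) * cubic_monom 2 + Const (v$4) * cubic_monom 3"

definition coeffs :: "(2, 'a::comm_ring_1) mpoly \<Rightarrow> 'a ^ 4" where
  "coeffs q = vector [cubic_coeff q 0, cubic_coeff q 1, cubic_coeff q 2, cubic_coeff q 3]"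

lemma atMost_three_sum: "(\<Sum>j\<le>3. f j) = f 0 + f 1 + f 2 + f (3::nat)"
  by (simp add: numeral_3_eq_3 numeral_2_eq_2)

lemma form_in_binary_cubics: "form v \<in> binary_cubics"
  unfolding binary_cubics_iff atMost_three_sum form_def
  by (rule exI[of _ "\<lambda>j. if j = 0 then v$1 else if j = 1 then v$2 else if j = 2 then v$3 else v$4"]) simp

lemma form_coeffs:
  assumes "q \<in> binary_cubics"
  shows "form (coeffs q) = q"
proof -
  obtain a where a: "q = (\<Sum>j\<le>3. Const (a j) * cubic_monom j)"
    using assms binary_cubics_iff by blast
  have inj: "cubic_expo i = cubic_expo j \<longleftrightarrow> i = j" for i j
    by (metis lookup_cubic_expo(2))
  have "q = (\<Sum>j\<le>3. Poly_Mapping.single (cubic_expo j) (a j))"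
    unfolding a by (rule sum.cong) (simp_all add: cubic_monom_eq Const_def mult_single)
  then have "cubic_coeff q j = a j" if "j \<le> 3" for j
    using that by (simp add: cubic_coeff_def lookup_sum lookup_single when_def inj)
  then show ?thesis
    by (simp add: form_def coeffs_def a atMost_three_sum)
qed

lemma form_add: "form (v + w) = form v + form w"
  by (simp add: form_def Const_hom algebra_simps)

lemma form_scale: "form (c *s v) = Const c * form v"
  by (simp add: form_def Const_hom algebra_simps)

lemma form_axis:
  "form (axis 1 1) = cubic_monom 0" "form (axis 2 1) = cubic_monom 1"
  "form (axis 3 1) = cubic_monom 2" "form (axis 4 1) = cubic_monom 3"
  by (simp_all add: form_def axis_def Const_hom)

lemma form_comp_form: "form_comp (form v) g = form (act g v)"
  unfolding form_comp_def form_def cubic_monom_def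
  by (simp add: mp_subst_hom sum_2 act_def Let_def Const_hom)
    (simp add: power2_eq_square power3_eq_cube algebra_simps)

text \<open>Transposed because \<open>vector\<close> lists rows, while the images of the monomials
  must be the columns.\<close>

definition coeff_matrix :: "((2, 'a::comm_ring_1) mpoly \<Rightarrow> (2, 'a) mpoly) \<Rightarrow> 'a ^ 4 ^ 4" where
  "coeff_matrix \<phi> = transpose (vector
     [coeffs (\<phi> (cubic_monom 0)), coeffs (\<phi> (cubic_monom 1)),
      coeffs (\<phi> (cubic_monom 2)), coeffs (\<phi> (cubic_monom 3))])"

lemma coeff_matrix_mult:
  fixes v :: "'a::comm_ring_1 ^ 4"
  shows "coeff_matrix \<phi> *v v =
    v$1 *s coeffs (\<phi> (cubic_monom 0)) + v$2 *s coeffs (\<phi> (cubic_monom 1))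
    + v$3 *s coeffs (\<phi> (cubic_monom 2)) + v$4 *s coeffs (\<phi> (cubic_monom 3))"
  by (simp add: coeff_matrix_def matrix_vector_mult_def transpose_def sum_4 vec_eq_iff mult.commute)

lemma cubic_linear_form:
  assumes "cubic_linear \<phi>"
  shows "\<phi> (form v) = form (coeff_matrix \<phi> *v v)"
proof -
  have add: "\<phi> (form (u + w)) = \<phi> (form u) + \<phi> (form w)"
    and scale: "\<phi> (form (c *s u)) = Const c * \<phi> (form u)"
    and closed: "form (coeffs (\<phi> (form u))) = \<phi> (form u)" for u w c
    using assms form_in_binary_cubics form_coeffs
    unfolding cubic_linear_def form_add form_scale by blast+
  have v: "v = v$1 *s axis 1 1 + v$2 *s axis 2 1 + v$3 *s axis 3 1 + v$4 *s axis 4 1"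
    by (simp add: vec_eq_iff forall_4 axis_def)
  have "\<phi> (form v) = \<phi> (form (v$1 *s axis 1 1 + v$2 *s axis 2 1 + v$3 *s axis 3 1 + v$4 *s axis 4 1))"
    by (rule arg_cong[OF v])
  also have "\<dots> = form (coeff_matrix \<phi> *v v)"
    unfolding coeff_matrix_mult add scale form_axis[symmetric]
    by (simp only: form_add form_scale closed)
  finally show ?thesis .
qed

text \<open>The formal identity is evaluated at \<open>v\<close> by a second substitution, of
  constants for the variables.\<close>

lemma preserves_disc_coeff_matrix:
  fixes \<phi> :: "(2, 'a::comm_ring_1) mpoly \<Rightarrow> (2, 'a) mpoly"
  assumes "preserves_disc \<phi>"
  shows "disc (coeff_matrix \<phi> *v v) = disc v"
proof -
  define \<tau> :: "nat \<Rightarrow> (nat, 'a) mpoly" where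
    "\<tau> j = Const (if j = 0 then v$1 else if j = 1 then v$2 else if j = 2 then v$3 else v$4)" for j
  have coord: "mp_subst \<tau> (cubic_coord \<phi> 0) = Const ((coeff_matrix \<phi> *v v)$1)"
    "mp_subst \<tau> (cubic_coord \<phi> 1) = Const ((coeff_matrix \<phi> *v v)$2)"
    "mp_subst \<tau> (cubic_coord \<phi> 2) = Const ((coeff_matrix \<phi> *v v)$3)"
    "mp_subst \<tau> (cubic_coord \<phi> 3) = Const ((coeff_matrix \<phi> *v v)$4)"
    unfolding cubic_coord_def atMost_three_sum coeff_matrix_mult coeffs_def
    by (simp_all add: mp_subst_hom \<tau>_def Const_hom mult.commute)
  have "mp_subst \<tau> (mp_subst (cubic_coord \<phi>) cubic_disc) = mp_subst \<tau> cubic_disc"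
    using assms by (simp add: preserves_disc_def)
  then have "Const (disc (coeff_matrix \<phi> *v v)) = (Const (disc v) :: (nat, 'a) mpoly)"
    unfolding cubic_disc_def mp_subst_hom coord by (simp add: disc_def Const_hom \<tau>_def)
  then show ?thesis by simp
qed

theorem corollary8p3:
  fixes \<phi> :: "(2, 'a::field) mpoly \<Rightarrow> (2, 'a) mpoly"
  assumes "CHAR('a) \<noteq> 2" and "CHAR('a) \<noteq> 3"
    and "cubic_linear \<phi>" and "preserves_disc \<phi>"
  shows "\<exists>(c::'a) (g::'a ^ 2 ^ 2). c \<noteq> 0 \<and> invertible g \<and> c ^ 4 * det g ^ 6 = 1 \<and>
           (\<forall>q\<in>binary_cubics. \<phi> q = Const c * form_comp q g)"
proof -
  \<comment> \<open>Otherwise the characteristic would be a positive divisor of \<open>p\<close>,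
    hence 1, 2 or 3; the value 1 is impossible in a field.\<close>
  have "of_nat p \<noteq> (0::'a)" if "p = 2 \<or> p = 3" for p
  proof
    assume "of_nat p = (0::'a)"
    then have "CHAR('a) dvd p"
      by (simp add: of_nat_eq_0_iff_char_dvd)
    moreover from this have "CHAR('a) \<noteq> 0"
      using that by (metis dvd_0_left_iff zero_neq_numeral)
    moreover have "CHAR('a) \<le> 3"
      using calculation(1) that dvd_imp_le[of "CHAR('a)" p] by auto
    ultimately show False
      using assms(1,2) CHAR_not_1[where 'a = 'a] by linarith
  qed
  from this[of 2] this[of 3] have "(2::'a) \<noteq> 0" "(3::'a) \<noteq> 0"
    by simp_all
  then obtain c and g :: "'a ^ 2 ^ 2" where c: "c \<noteq> 0" "det g \<noteq> 0" "c ^ 4 * det g ^ 6 = 1"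
    and mat: "\<And>v. coeff_matrix \<phi> *v v = c *s act g v"
    using disc_preserving_matrix[OF _ _ preserves_disc_coeff_matrix[OF assms(4)]] by metis
  have "\<phi> q = Const c * form_comp q g" if "q \<in> binary_cubics" for q
  proof -
    have "\<phi> (form (coeffs q)) = Const c * form_comp (form (coeffs q)) g"
      by (simp add: cubic_linear_form[OF assms(3)] mat form_scale form_comp_form)
    then show ?thesis
      by (simp add: form_coeffs[OF that])
  qed
  with c show ?thesis
    by (auto simp: invertible_det_nz)
qed

end
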